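(* Let $K$ and $K'$ be two finite simplicial complexes, and let $L\subseteq K$ and $L'\subseteq K'$ be subcomplexes. If $(K,L)$ and $(K',L')$ have the same strong homotopy type, then $TC(K,L)=TC(K',L')$.
   Context: Simplicial complexes are abstract simplicial complexes. The categorical product $K\prod L$ of simplicial complexes has vertex set $V(K)\times V(L)$, and a finite set $\sigma$ of vertices is a simplex iff its projections $p_1(\sigma)$ and $p_2(\sigma)$ are simplices of $K$ and $L$ respectively. Two simplicial maps $\phi,\psi:K\to M$ are contiguous, $\phi\sim_c\psi$, if $\phi(\sigma)\cup\psi(\sigma)$ is a simplex of $M$ for every simplex $\sigma$ of $K$. They are in the same contiguity class, $\phi\sim\psi$, if there is a finite sequence of simplicial maps $\phi=\phi_0\sim_c\phi_1\sim_c\cdots\sim_c\phi_n=\psi$. For a subcomplex $L\subseteq K$, the targeted simplicial complexity $TC(K,L)$ is the least integer $n\ge 0$ such that $K\prod L$ can be covered by $n+1$ subcomplexes $\Omega_0,\dots,\Omega_n$ such that for each $i$ there is a simplicial map $\sigma_i:\Omega_i\to L$ with $\Delta_L\circ\sigma_i\sim i_{\Omega_i}$, where $\Delta_L:L\to K\prod L$, $\Delta_L(v)=(v,v)$, and $i_{\Omega_i}:\Omega_i\to K\prod L$ is the inclusion (and $TC(K,L)=\infty$ if no such $n$ exists). Let $Z$ be the one-dimensional simplicial complex with vertices the integers and edges $\{i,i+1\}$. A Moore path in $K$ is a simplicial map $\gamma:Z\to K$ that is constant on all $i\le i^-$ and constant on all $i\ge i^+$ for some integers $i^-,i^+$. Its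 initial vertex $\alpha(\gamma)$ is the value $\gamma(i)$ for all sufficiently small $i$, and its final vertex $\omega(\gamma)$ is the value $\gamma(i)$ for all sufficiently large $i$. The Moore path complex $PK$ has the Moore paths in $K$ as vertices, and $\{\gamma_0,\dots,\gamma_p\}$ is a simplex iff $\{\gamma_0(i),\dots,\gamma_p(i),\gamma_0(i+1),\dots,\gamma_p(i+1)\}$ is a simplex of $K$ for every integer $i$. The maps $\alpha,\omega:PK\to K$ are simplicial. A p-homotopy from $f$ to $g$, for simplicial maps $f,g:K\to M$, is a simplicial map $H:K\to PM$ with $\alpha\circ H=f$ and $\omega\circ H=g$. The pairs $(K,L)$ and $(K',L')$ have the same strong homotopy type if: (i) there exist simplicial maps $\phi:K\to K'$ and $\psi:K'\to K$ with $\phi(L)\subseteq L'$ and $\psi(L')\subseteq L$; (ii) there is a p-homotopy $F:K\to PK$ with $\alpha\circ F=id_K$, $\omega\circ F=\psi\circ\phi$ and $F(v)(t)\in L$ for all $v\in L$ and all $t$; (iii) there is a p-homotopy $H:K'\to PK'$ with $\alpha\circ H=id_{K'}$, $\omega\circ H=\phi\circ\psi$ and $H(w)(t)\in L'$ for all $w\in L'$ and all $t$. *)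

theory Defs
  imports Complex_Main "HOL-Library.Extended_Nat"
begin

text \<open>
  An abstract simplicial complex is identified with its set of (finite, non-empty) simplices.
  Its vertices are the elements of its simplices, so vertex sets may be proper subsets of a type;
  the empty complex is allowed.
\<close>

definition simplicial_complex :: "'a set set \<Rightarrow> bool" where
  "simplicial_complex K \<longleftrightarrow>
     (\<forall>\<sigma>\<in>K. finite \<sigma> \<and> \<sigma> \<noteq> {} \<and> (\<forall>\<tau>. \<tau> \<subseteq> \<sigma> \<and> \<tau> \<noteq> {} \<longrightarrow> \<tau> \<in> K))"

definition vertices :: "'a set set \<Rightarrow> 'a set" where
  "vertices K = \<Union>K"

definition subcomplex :: "'a set set \<Rightarrow> 'a set set \<Rightarrow> bool" where
  "subcomplex L K \<longleftrightarrow> simplicial_complex L \<and> L \<subseteq> K"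

text \<open>
  Maps between complexes are total functions of which only the values on vertices matter.
\<close>

definition simplicial_map :: "'a set set \<Rightarrow> 'b set set \<Rightarrow> ('a \<Rightarrow> 'b) \<Rightarrow> bool" where
  "simplicial_map K M f \<longleftrightarrow> (\<forall>\<sigma>\<in>K. f ` \<sigma> \<in> M)"

definition cat_product :: "'a set set \<Rightarrow> 'b set set \<Rightarrow> ('a \<times> 'b) set set" where
  "cat_product K L = {\<sigma>. finite \<sigma> \<and> fst ` \<sigma> \<in> K \<and> snd ` \<sigma> \<in> L}"

lemma vertices_cat_product:
  assumes "simplicial_complex K" "simplicial_complex L"
  shows "vertices (cat_product K L) = vertices K \<times> vertices L"
proof (intro set_eqI iffI)
  fix x assume "x \<in> vertices (cat_product K L)"
  then obtain \<sigma> where "x \<in> \<sigma>" "fst ` \<sigma> \<in> K" "snd ` \<sigma> \<in> L"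
    by (auto simp: vertices_def cat_product_def)
  then have "fst x \<in> vertices K" "snd x \<in> vertices L"
    unfolding vertices_def by blast+
  then show "x \<in> vertices K \<times> vertices L"
    by (simp add: mem_Times_iff)
next
  fix x assume "x \<in> vertices K \<times> vertices L"
  then obtain \<sigma> \<tau> where "fst x \<in> \<sigma>" "\<sigma> \<in> K" "snd x \<in> \<tau>" "\<tau> \<in> L"
    by (auto simp: vertices_def mem_Times_iff)
  then have "{fst x} \<in> K" "{snd x} \<in> L"
    using assms unfolding simplicial_complex_def by (meson empty_subsetI insert_not_empty insert_subset)+
  then have "{x} \<in> cat_product K L"
    by (simp add: cat_product_def)
  then show "x \<in> vertices (cat_product K L)"
    by (auto simp: vertices_def)
qed

definition contiguous :: "'a set set \<Rightarrow> 'b set set \<Rightarrow> ('a \<Rightarrow> 'b) \<Rightarrow> ('a \<Rightarrow> 'b) \<Rightarrow> bool" where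
  "contiguous K M \<phi> \<psi> \<longleftrightarrow> simplicial_map K M \<phi> \<and> simplicial_map K M \<psi> \<and>
     (\<forall>\<sigma>\<in>K. \<phi> ` \<sigma> \<union> \<psi> ` \<sigma> \<in> M)"

text \<open>
  Simplicial maps that agree on all vertices of \<open>K\<close> are contiguous, so the equality of total
  functions in the reflexive case of the closure is harmless.
\<close>

definition same_contiguity_class ::
    "'a set set \<Rightarrow> 'b set set \<Rightarrow> ('a \<Rightarrow> 'b) \<Rightarrow> ('a \<Rightarrow> 'b) \<Rightarrow> bool" where
  "same_contiguity_class K M \<phi> \<psi> \<longleftrightarrow> simplicial_map K M \<phi> \<and> simplicial_map K M \<psi> \<and>
     (contiguous K M)\<^sup>*\<^sup>* \<phi> \<psi>"

lemma same_contiguity_class_if_eq_on_vertices: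
  assumes "simplicial_map K M \<phi>" "\<And>v. v \<in> vertices K \<Longrightarrow> \<phi> v = \<psi> v"
  shows "same_contiguity_class K M \<phi> \<psi>"
proof -
  have eq: "\<phi> ` \<sigma> = \<psi> ` \<sigma>" if "\<sigma> \<in> K" for \<sigma>
    using that assms(2) by (intro image_cong) (auto simp: vertices_def)
  then have "contiguous K M \<phi> \<psi>"
    using assms(1) by (auto simp: contiguous_def simplicial_map_def)
  then show ?thesis
    by (auto simp: same_contiguity_class_def contiguous_def)
qed

definition diagonal :: "'a \<Rightarrow> 'a \<times> 'a" where
  "diagonal v = (v, v)"

text \<open>
  The infimum in \<^typ>\<open>enat\<close> is attained for a non-empty set and is \<open>\<infinity>\<close> for the empty set.
\<close>

definition TC :: "'a set set \<Rightarrow> 'a set set \<Rightarrow> enat" where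
  "TC K L = Inf {enat n | n.
     \<exists>\<Omega> :: nat \<Rightarrow> ('a \<times> 'a) set set.
       (\<forall>i\<le>n. subcomplex (\<Omega> i) (cat_product K L)) \<and>
       cat_product K L = (\<Union>i\<le>n. \<Omega> i) \<and>
       (\<forall>i\<le>n. \<exists>\<sigma>. simplicial_map (\<Omega> i) L \<sigma> \<and>
          same_contiguity_class (\<Omega> i) (cat_product K L) (diagonal \<circ> \<sigma>) id)}"

definition int_line :: "int set set" where
  "int_line = {{i} | i. True} \<union> {{i, i + 1} | i. True}"

definition moore_path :: "'a set set \<Rightarrow> (int \<Rightarrow> 'a) \<Rightarrow> bool" where
  "moore_path K \<gamma> \<longleftrightarrow> simplicial_map int_line K \<gamma> \<and>
     (\<exists>m p. (\<forall>i\<le>m. \<gamma> i = \<gamma> m) \<and> (\<forall>i\<ge>p. \<gamma> i = \<gamma> p))"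

definition initial_vertex :: "(int \<Rightarrow> 'a) \<Rightarrow> 'a" where
  "initial_vertex \<gamma> = (THE v. \<forall>\<^sub>F i in at_bot. \<gamma> i = v)"

definition final_vertex :: "(int \<Rightarrow> 'a) \<Rightarrow> 'a" where
  "final_vertex \<gamma> = (THE v. \<forall>\<^sub>F i in at_top. \<gamma> i = v)"

lemma initial_vertex_eq:
  assumes "\<And>i. i \<le> m \<Longrightarrow> \<gamma> i = v"
  shows "initial_vertex \<gamma> = v"
  unfolding initial_vertex_def
proof (rule the_equality)
  show ev: "\<forall>\<^sub>F i in at_bot. \<gamma> i = v"
    using assms by (auto simp: eventually_at_bot_linorder)
  fix w assume "\<forall>\<^sub>F i in at_bot. \<gamma> i = w"
  with ev have "\<forall>\<^sub>F i in (at_bot :: int filter). w = v"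
    by eventually_elim simp
  then show "w = v" by simp
qed

lemma final_vertex_eq:
  assumes "\<And>i. i \<ge> p \<Longrightarrow> \<gamma> i = v"
  shows "final_vertex \<gamma> = v"
  unfolding final_vertex_def
proof (rule the_equality)
  show ev: "\<forall>\<^sub>F i in at_top. \<gamma> i = v"
    using assms by (auto simp: eventually_at_top_linorder)
  fix w assume "\<forall>\<^sub>F i in at_top. \<gamma> i = w"
  with ev have "\<forall>\<^sub>F i in (at_top :: int filter). w = v"
    by eventually_elim simp
  then show "w = v" by simp
qed

definition moore_path_complex :: "'a set set \<Rightarrow> (int \<Rightarrow> 'a) set set" where
  "moore_path_complex K = {S. finite S \<and> S \<noteq> {} \<and> (\<forall>\<gamma>\<in>S. moore_path K \<gamma>) \<and>
     (\<forall>i. (\<lambda>\<gamma>. \<gamma> i) ` S \<union> (\<lambda>\<gamma>. \<gamma> (i + 1)) ` S \<in> K)}"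

definition p_homotopy ::
    "'a set set \<Rightarrow> 'b set set \<Rightarrow> ('a \<Rightarrow> 'b) \<Rightarrow> ('a \<Rightarrow> 'b) \<Rightarrow> ('a \<Rightarrow> int \<Rightarrow> 'b) \<Rightarrow> bool" where
  "p_homotopy K M f g H \<longleftrightarrow> simplicial_map K M f \<and> simplicial_map K M g \<and>
     simplicial_map K (moore_path_complex M) H \<and>
     (\<forall>v\<in>vertices K. initial_vertex (H v) = f v \<and> final_vertex (H v) = g v)"

text \<open>
  The inclusions \<open>\<phi>(L) \<subseteq> L'\<close> and \<open>\<psi>(L') \<subseteq> L\<close> are inclusions of complexes (simplices go to
  simplices of the subcomplex), while \<open>F(v)(t) \<in> L\<close> only says that the point is a vertex of
  \<open>L\<close>: consecutive points of the path \<open>F(v)\<close> need not span a simplex of \<open>L\<close>.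
\<close>

definition same_strong_homotopy_type ::
    "'a set set \<Rightarrow> 'a set set \<Rightarrow> 'b set set \<Rightarrow> 'b set set \<Rightarrow> bool" where
  "same_strong_homotopy_type K L K' L' \<longleftrightarrow>
     (\<exists>\<phi> \<psi>. simplicial_map K K' \<phi> \<and> simplicial_map K' K \<psi> \<and>
        (\<forall>\<sigma>\<in>L. \<phi> ` \<sigma> \<in> L') \<and> (\<forall>\<sigma>\<in>L'. \<psi> ` \<sigma> \<in> L) \<and>
        (\<exists>F. p_homotopy K K id (\<psi> \<circ> \<phi>) F \<and>
             (\<forall>v\<in>vertices L. \<forall>t. F v t \<in> vertices L)) \<and>
        (\<exists>H. p_homotopy K' K' id (\<phi> \<circ> \<psi>) H \<and>
             (\<forall>w\<in>vertices L'. \<forall>t. H w t \<in> vertices L')))"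

end

theory Submission imports Defs begin

text \<open>
  The key is that the planner \<open>\<sigma>\<close> in the definition of \<open>TC K L\<close> can be eliminated, which moves
  every comparison of maps into the ambient complex \<open>K\<close>. A planner on \<open>\<Omega>\<close> with \<open>\<Delta>\<^sub>L \<circ> \<sigma>\<close> in the class of the
  inclusion gives, by composing with the two projections, \<open>\<sigma> \<sim> p\<^sub>1\<close> in \<open>K\<close> and \<open>\<sigma> \<sim> p\<^sub>2\<close> in \<open>L\<close>,
  hence \<open>p\<^sub>1 \<sim> p\<^sub>2\<close> as maps \<open>\<Omega> \<rightarrow> K\<close>. Conversely, if \<open>p\<^sub>1 \<sim> p\<^sub>2\<close> in \<open>K\<close>, then \<open>\<sigma> = p\<^sub>2\<close> is a
  planner, since \<open>\<Delta>\<^sub>L \<circ> p\<^sub>2 = (p\<^sub>2, p\<^sub>2) \<sim> (p\<^sub>1, p\<^sub>2)\<close>. So \<open>TC K L\<close> counts the pieces of a cover on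
  which the projections are in the same contiguity class as maps into \<open>K\<close> (\<open>TC_projections\<close>).

  In this form \<open>TC\<close> is monotone under domination (\<open>TC_le_if_dominated\<close>): if \<open>\<phi>\<close> maps \<open>L\<close> to \<open>L'\<close>
  and \<open>\<psi> \<circ> \<phi> \<sim> id\<close> on \<open>K\<close>, pull a cover of \<open>K' \<Prod> L'\<close> back along \<open>\<phi> \<times> \<phi>\<close>; on each piece
  \<open>p\<^sub>1 \<sim> \<psi>\<phi>p\<^sub>1 = \<psi>p\<^sub>1(\<phi> \<times> \<phi>) \<sim> \<psi>p\<^sub>2(\<phi> \<times> \<phi>) = \<psi>\<phi>p\<^sub>2 \<sim> p\<^sub>2\<close>.
  Finally, a p-homotopy on a finite complex is a finite chain of contiguities, namely its time
  slices (\<open>same_contiguity_class_if_p_homotopy\<close>), so a strong homotopy equivalence of pairs gives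
  domination in both directions.
\<close>

lemma simplicial_complex_face:
  "simplicial_complex K \<Longrightarrow> \<sigma> \<in> K \<Longrightarrow> \<tau> \<subseteq> \<sigma> \<Longrightarrow> \<tau> \<noteq> {} \<Longrightarrow> \<tau> \<in> K"
  unfolding simplicial_complex_def by blast

lemma simplicial_map_comp:
  "simplicial_map K M f \<Longrightarrow> simplicial_map M N g \<Longrightarrow> simplicial_map K N (g \<circ> f)"
  unfolding simplicial_map_def by (metis image_comp)

lemma simplicial_complex_cat_product:
  assumes "simplicial_complex K" "simplicial_complex L"
  shows "simplicial_complex (cat_product K L)"
  unfolding simplicial_complex_def
proof (intro ballI conjI allI impI)
  fix \<sigma> assume \<sigma>: "\<sigma> \<in> cat_product K L"
  then show "finite \<sigma>" by (simp add: cat_product_def)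
  show "\<sigma> \<noteq> {}"
    using \<sigma> assms(1) by (auto simp: cat_product_def simplicial_complex_def)
  fix \<tau> assume \<tau>: "\<tau> \<subseteq> \<sigma> \<and> \<tau> \<noteq> {}"
  then have "fst ` \<tau> \<subseteq> fst ` \<sigma>" "snd ` \<tau> \<subseteq> snd ` \<sigma>" "finite \<tau>"
    using \<open>finite \<sigma>\<close> by (auto intro: finite_subset)
  with \<tau> \<sigma> show "\<tau> \<in> cat_product K L"
    using assms[THEN simplicial_complex_face, of _ "_ ` \<tau>"] unfolding cat_product_def by blast
qed

lemma simplicial_map_fst: "simplicial_map (cat_product K L) K fst"
  and simplicial_map_snd: "simplicial_map (cat_product K L) L snd"
  by (auto simp: simplicial_map_def cat_product_def)

section \<open>Contiguity classes\<close>

lemma contiguous_imp_simplicial_map: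
  "contiguous K M f g \<Longrightarrow> simplicial_map K M f"
  "contiguous K M f g \<Longrightarrow> simplicial_map K M g"
  by (simp_all add: contiguous_def)

lemma same_contiguity_class_if_contiguous:
  "contiguous K M f g \<Longrightarrow> same_contiguity_class K M f g"
  by (simp add: same_contiguity_class_def contiguous_imp_simplicial_map r_into_rtranclp)

lemma same_contiguity_class_sym:
  assumes "same_contiguity_class K M f g"
  shows "same_contiguity_class K M g f"
proof -
  have "symp (contiguous K M)"
    by (rule sympI) (simp add: contiguous_def Un_commute)
  then show ?thesis
    using assms by (simp add: same_contiguity_class_def symp_rtranclp[THEN sympD])
qed

lemma same_contiguity_class_trans:
  "same_contiguity_class K M f g \<Longrightarrow> same_contiguity_class K M g h
    \<Longrightarrow> same_contiguity_class K M f h"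
  by (auto simp: same_contiguity_class_def)

text \<open>
  Every operation on maps that preserves single contiguities preserves classes. Composition on
  either side and pairing with a fixed map are instances.
\<close>
lemma same_contiguity_class_transfer:
  assumes "same_contiguity_class K M f g"
    and "simplicial_map K' M' (T f)"
    and step: "\<And>f g. contiguous K M f g \<Longrightarrow> contiguous K' M' (T f) (T g)"
  shows "same_contiguity_class K' M' (T f) (T g)"
proof -
  have "(contiguous K M)\<^sup>*\<^sup>* f g"
    using assms(1) by (simp add: same_contiguity_class_def)
  then have "same_contiguity_class K' M' (T f) (T g)"
  proof induction
    case base
    show ?case using assms(2) by (simp add: same_contiguity_class_def)
  next
    case (step g h)
    then show ?case
      using assms(3) same_contiguity_class_if_contiguous same_contiguity_class_trans by metis
  qed
  then show ?thesis .
qed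

lemma same_contiguity_class_comp_left:
  assumes "same_contiguity_class K M f g" and h: "simplicial_map M N h"
  shows "same_contiguity_class K N (h \<circ> f) (h \<circ> g)"
proof (rule same_contiguity_class_transfer[OF assms(1), where T = "\<lambda>f. h \<circ> f"])
  show "simplicial_map K N (h \<circ> f)"
    using assms by (auto simp: same_contiguity_class_def intro: simplicial_map_comp)
  fix f g assume "contiguous K M f g"
  then show "contiguous K N (h \<circ> f) (h \<circ> g)"
    using h unfolding contiguous_def simplicial_map_def by (metis image_Un image_comp)
qed

lemma same_contiguity_class_comp_right:
  assumes "same_contiguity_class K M f g" and h: "simplicial_map J K h"
  shows "same_contiguity_class J M (f \<circ> h) (g \<circ> h)"
proof (rule same_contiguity_class_transfer[OF assms(1), where T = "\<lambda>f. f \<circ> h"])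
  show "simplicial_map J M (f \<circ> h)"
    using assms by (auto simp: same_contiguity_class_def intro: simplicial_map_comp)
  fix f g assume "contiguous K M f g"
  then show "contiguous J M (f \<circ> h) (g \<circ> h)"
    using h unfolding contiguous_def simplicial_map_def by (metis image_comp)
qed

lemma same_contiguity_class_mono:
  assumes "same_contiguity_class K M f g" and "M \<subseteq> N"
  shows "same_contiguity_class K N f g"
  using same_contiguity_class_comp_left[OF assms(1), of N id] assms(2)
  by (auto simp: simplicial_map_def)

lemma same_contiguity_class_pair:
  assumes "same_contiguity_class \<Omega> K f g" and h: "simplicial_map \<Omega> L h"
    and \<Omega>: "\<And>\<sigma>. \<sigma> \<in> \<Omega> \<Longrightarrow> finite \<sigma>"
  shows "same_contiguity_class \<Omega> (cat_product K L) (\<lambda>x. (f x, h x)) (\<lambda>x. (g x, h x))"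
proof (rule same_contiguity_class_transfer[OF assms(1), where T = "\<lambda>f x. (f x, h x)"])
  have pair: "simplicial_map \<Omega> (cat_product K L) (\<lambda>x. (f x, h x))" if "simplicial_map \<Omega> K f" for f
    using that h \<Omega> by (auto simp: simplicial_map_def cat_product_def image_image)
  then show "simplicial_map \<Omega> (cat_product K L) (\<lambda>x. (f x, h x))"
    using assms(1) by (simp add: same_contiguity_class_def)
  fix f g assume "contiguous \<Omega> K f g"
  then show "contiguous \<Omega> (cat_product K L) (\<lambda>x. (f x, h x)) (\<lambda>x. (g x, h x))"
    using h \<Omega> pair
    by (auto simp: contiguous_def simplicial_map_def cat_product_def image_Un image_image)
qed

section \<open>Homotopies and contiguity classes\<close>

text \<open>
  The time slices \<open>\<lambda>v. H v t\<close> of a p-homotopy are simplicial, consecutive ones are contiguous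
  by the definition of simplices of Moore paths, and finiteness gives times before and after which
  all paths \<open>H v\<close> rest simultaneously.
\<close>
lemma same_contiguity_class_if_p_homotopy:
  assumes K: "simplicial_complex K" "finite K" and M: "simplicial_complex M"
    and hom: "p_homotopy K M f g H"
  shows "same_contiguity_class K M f g"
proof -
  have H: "simplicial_map K (moore_path_complex M) H"
    and f: "simplicial_map K M f" and g: "simplicial_map K M g"
    and ends: "\<And>v. v \<in> vertices K \<Longrightarrow> initial_vertex (H v) = f v \<and> final_vertex (H v) = g v"
    using hom by (auto simp: p_homotopy_def)
  have step_M: "(\<lambda>v. H v t) ` \<sigma> \<union> (\<lambda>v. H v (t + 1)) ` \<sigma> \<in> M" if "\<sigma> \<in> K" for \<sigma> t
  proof -
    have "H ` \<sigma> \<in> moore_path_complex M"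
      using H that by (simp add: simplicial_map_def)
    then show ?thesis by (simp add: moore_path_complex_def image_image)
  qed
  have slice: "simplicial_map K M (\<lambda>v. H v t)" for t
    unfolding simplicial_map_def
  proof
    fix \<sigma> assume "\<sigma> \<in> K"
    moreover from this have "\<sigma> \<noteq> {}"
      using K(1) by (auto simp: simplicial_complex_def)
    ultimately show "(\<lambda>v. H v t) ` \<sigma> \<in> M"
      using step_M[of \<sigma> t] M unfolding simplicial_complex_def
      by (meson Un_upper1 image_is_empty)
  qed
  have consecutive: "same_contiguity_class K M (\<lambda>v. H v t) (\<lambda>v. H v (t + 1))" for t
    using step_M slice
    by (intro same_contiguity_class_if_contiguous) (simp add: contiguous_def)
  have slices: "same_contiguity_class K M (\<lambda>v. H v s) (\<lambda>v. H v t)" if "s \<le> t" for s t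
    using that
  proof (induction t rule: int_ge_induct)
    case base
    show ?case using slice by (simp add: same_contiguity_class_def)
  next
    case (step t)
    then show ?case using consecutive
      by (blast intro: same_contiguity_class_trans)
  qed
  have "\<exists>m p. (\<forall>t\<le>m. H v t = f v) \<and> (\<forall>t\<ge>p. H v t = g v)" if "v \<in> vertices K" for v
  proof -
    from that obtain \<sigma> where "\<sigma> \<in> K" "v \<in> \<sigma>" by (auto simp: vertices_def)
    then have "moore_path M (H v)"
      using H by (auto simp: simplicial_map_def moore_path_complex_def)
    then obtain m p where mp: "\<forall>t\<le>m. H v t = H v m" "\<forall>t\<ge>p. H v t = H v p"
      by (auto simp: moore_path_def)
    then have "initial_vertex (H v) = H v m" "final_vertex (H v) = H v p"
      by (blast intro: initial_vertex_eq final_vertex_eq)+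
    then have "H v m = f v" "H v p = g v"
      using ends[OF that] by simp_all
    with mp show ?thesis by metis
  qed
  then obtain m p where mp: "\<And>v t. v \<in> vertices K \<Longrightarrow> t \<le> m v \<Longrightarrow> H v t = f v"
    "\<And>v t. v \<in> vertices K \<Longrightarrow> t \<ge> p v \<Longrightarrow> H v t = g v" by metis
  have fin: "finite (vertices K)"
    using K by (auto simp: vertices_def simplicial_complex_def)
  \<comment> \<open>The additional \<open>0\<close> keeps both sets nonempty for the empty complex and orders \<open>a \<le> b\<close>.\<close>
  define a where "a = Min (insert 0 (m ` vertices K))"
  define b where "b = Max (insert 0 (p ` vertices K))"
  have ab: "a \<le> 0" "0 \<le> b" "\<And>v. v \<in> vertices K \<Longrightarrow> a \<le> m v \<and> p v \<le> b"
    using fin by (auto simp: a_def b_def)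
  have "same_contiguity_class K M f (\<lambda>v. H v a)"
    using f mp(1) ab(3) by (intro same_contiguity_class_if_eq_on_vertices) auto
  moreover have "same_contiguity_class K M (\<lambda>v. H v a) (\<lambda>v. H v b)"
    using ab by (intro slices) simp
  moreover have "same_contiguity_class K M (\<lambda>v. H v b) g"
    using g mp(2) ab(3)
    by (intro same_contiguity_class_sym[OF same_contiguity_class_if_eq_on_vertices]) auto
  ultimately show ?thesis
    by (blast intro: same_contiguity_class_trans)
qed

section \<open>Targeted complexity through the two projections\<close>

text \<open>
  A planner is a common partner of both projections, and the second projection, which already
  has values in \<open>L\<close>, is itself a planner whenever any planner exists.
\<close>
lemma planner_iff_projections:
  assumes K: "simplicial_complex K" and L: "subcomplex L K"
    and \<Omega>: "subcomplex \<Omega> (cat_product K L)"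
  shows "(\<exists>\<sigma>. simplicial_map \<Omega> L \<sigma> \<and>
            same_contiguity_class \<Omega> (cat_product K L) (diagonal \<circ> \<sigma>) id)
         \<longleftrightarrow> same_contiguity_class \<Omega> K fst snd"
proof
  assume "\<exists>\<sigma>. simplicial_map \<Omega> L \<sigma> \<and>
            same_contiguity_class \<Omega> (cat_product K L) (diagonal \<circ> \<sigma>) id"
  then obtain \<sigma> where \<sigma>: "same_contiguity_class \<Omega> (cat_product K L) (diagonal \<circ> \<sigma>) id"
    by blast
  have proj: "fst \<circ> (diagonal \<circ> \<sigma>) = \<sigma>" "snd \<circ> (diagonal \<circ> \<sigma>) = \<sigma>"
    by (auto simp: diagonal_def)
  have "same_contiguity_class \<Omega> K \<sigma> fst"
    using same_contiguity_class_comp_left[OF \<sigma> simplicial_map_fst] by (simp add: proj)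
  moreover have "same_contiguity_class \<Omega> L \<sigma> snd"
    using same_contiguity_class_comp_left[OF \<sigma> simplicial_map_snd] by (simp add: proj)
  then have "same_contiguity_class \<Omega> K \<sigma> snd"
    using L by (auto simp: subcomplex_def intro: same_contiguity_class_mono)
  ultimately show "same_contiguity_class \<Omega> K fst snd"
    by (blast intro: same_contiguity_class_trans same_contiguity_class_sym)
next
  assume "same_contiguity_class \<Omega> K fst snd"
  then have sf: "same_contiguity_class \<Omega> K snd fst"
    by (rule same_contiguity_class_sym)
  have snd: "simplicial_map \<Omega> L snd" and fin: "\<And>\<sigma>. \<sigma> \<in> \<Omega> \<Longrightarrow> finite \<sigma>"
    using \<Omega> by (auto simp: subcomplex_def cat_product_def simplicial_map_def)
  have "diagonal \<circ> snd = (\<lambda>x :: 'a \<times> 'a. (snd x, snd x))"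
    and "id = (\<lambda>x :: 'a \<times> 'a. (fst x, snd x))"
    by (auto simp: diagonal_def)
  then have "same_contiguity_class \<Omega> (cat_product K L) (diagonal \<circ> snd) id"
    using same_contiguity_class_pair[OF sf snd fin] by simp
  with snd show "\<exists>\<sigma>. simplicial_map \<Omega> L \<sigma> \<and>
            same_contiguity_class \<Omega> (cat_product K L) (diagonal \<circ> \<sigma>) id"
    by blast
qed

lemma TC_projections:
  assumes "simplicial_complex K" and "subcomplex L K"
  shows "TC K L = Inf {enat n | n.
     \<exists>\<Omega> :: nat \<Rightarrow> ('a \<times> 'a) set set.
       (\<forall>i\<le>n. subcomplex (\<Omega> i) (cat_product K L)) \<and>
       cat_product K L = (\<Union>i\<le>n. \<Omega> i) \<and>
       (\<forall>i\<le>n. same_contiguity_class (\<Omega> i) K fst snd)}"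
proof -
  have "(\<forall>i\<le>n. subcomplex (\<Omega> i) (cat_product K L)) \<and> cat_product K L = (\<Union>i\<le>n. \<Omega> i) \<and>
        (\<forall>i\<le>n. \<exists>\<sigma>. simplicial_map (\<Omega> i) L \<sigma> \<and>
          same_contiguity_class (\<Omega> i) (cat_product K L) (diagonal \<circ> \<sigma>) id)
      \<longleftrightarrow> (\<forall>i\<le>n. subcomplex (\<Omega> i) (cat_product K L)) \<and> cat_product K L = (\<Union>i\<le>n. \<Omega> i) \<and>
        (\<forall>i\<le>n. same_contiguity_class (\<Omega> i) K fst snd)"
    for n :: nat and \<Omega>
    using planner_iff_projections[OF assms] by blast
  then show ?thesis
    unfolding TC_def by (simp only:)
qed

text \<open>
  A cover of the product of the dominating pair, pulled back along \<open>\<phi> \<times> \<phi>\<close>, keeps its number of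
  pieces. On each piece the contiguity class of the projections is transported by \<open>\<psi>\<close>, and the
  result is corrected at both ends by \<open>\<psi> \<circ> \<phi> \<sim> id\<close> in \<open>K\<close>.
\<close>
lemma TC_le_if_dominated:
  fixes K L :: "'a set set" and K' L' :: "'b set set"
  assumes K: "simplicial_complex K" and K': "simplicial_complex K'"
    and L: "subcomplex L K" and L': "subcomplex L' K'"
    and \<phi>: "simplicial_map K K' \<phi>" and \<phi>L: "simplicial_map L L' \<phi>"
    and \<psi>: "simplicial_map K' K \<psi>"
    and dom: "same_contiguity_class K K id (\<psi> \<circ> \<phi>)"
  shows "TC K L \<le> TC K' L'"
  unfolding TC_projections[OF K L] TC_projections[OF K' L']
proof (rule Inf_superset_mono, rule subsetI, clarify)
  fix n and \<Omega>' :: "nat \<Rightarrow> ('b \<times> 'b) set set"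
  assume sub': "\<forall>i\<le>n. subcomplex (\<Omega>' i) (cat_product K' L')"
    and cover': "cat_product K' L' = (\<Union>i\<le>n. \<Omega>' i)"
    and proj': "\<forall>i\<le>n. same_contiguity_class (\<Omega>' i) K' fst snd"
  let ?\<phi>\<phi> = "map_prod \<phi> \<phi>"
  define \<Omega> where "\<Omega> i = {\<sigma> \<in> cat_product K L. ?\<phi>\<phi> ` \<sigma> \<in> \<Omega>' i}" for i
  have prod: "simplicial_complex (cat_product K L)"
    using K L by (auto simp: subcomplex_def intro: simplicial_complex_cat_product)
  have sub: "subcomplex (\<Omega> i) (cat_product K L)" if "i \<le> n" for i
  proof -
    have "simplicial_complex (\<Omega>' i)"
      using sub' that by (simp add: subcomplex_def)
    then have face: "\<tau> \<in> \<Omega> i" if "\<sigma> \<in> \<Omega> i" "\<tau> \<subseteq> \<sigma>" "\<tau> \<noteq> {}" for \<sigma> \<tau>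
      using that simplicial_complex_face[OF prod, of \<sigma> \<tau>]
        simplicial_complex_face[of "\<Omega>' i" "?\<phi>\<phi> ` \<sigma>" "?\<phi>\<phi> ` \<tau>"]
      by (simp add: \<Omega>_def image_mono)
    have "finite \<sigma> \<and> \<sigma> \<noteq> {}" if "\<sigma> \<in> \<Omega> i" for \<sigma>
      using that prod by (simp add: \<Omega>_def simplicial_complex_def)
    with face have "simplicial_complex (\<Omega> i)"
      unfolding simplicial_complex_def by blast
    then show ?thesis by (auto simp: subcomplex_def \<Omega>_def)
  qed
  have "?\<phi>\<phi> ` \<sigma> \<in> cat_product K' L'" if "\<sigma> \<in> cat_product K L" for \<sigma>
  proof -
    have "fst ` ?\<phi>\<phi> ` \<sigma> = \<phi> ` fst ` \<sigma>" "snd ` ?\<phi>\<phi> ` \<sigma> = \<phi> ` snd ` \<sigma>"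
      by (simp_all add: image_image)
    then show ?thesis
      using that \<phi> \<phi>L by (simp add: cat_product_def simplicial_map_def)
  qed
  then have cover: "cat_product K L = (\<Union>i\<le>n. \<Omega> i)"
    using cover' by (auto simp: \<Omega>_def)
  have proj: "same_contiguity_class (\<Omega> i) K fst snd" if i: "i \<le> n" for i
  proof -
    have \<phi>\<phi>: "simplicial_map (\<Omega> i) (\<Omega>' i) ?\<phi>\<phi>"
      by (simp add: simplicial_map_def \<Omega>_def)
    have p1: "simplicial_map (\<Omega> i) K fst" and p2: "simplicial_map (\<Omega> i) K snd"
      using L by (auto simp: simplicial_map_def \<Omega>_def cat_product_def subcomplex_def)
    have "same_contiguity_class (\<Omega> i) K fst (\<psi> \<circ> \<phi> \<circ> fst)"
      using same_contiguity_class_comp_right[OF dom p1] by simp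
    moreover have "same_contiguity_class (\<Omega> i) K (\<psi> \<circ> \<phi> \<circ> fst) (\<psi> \<circ> \<phi> \<circ> snd)"
      using same_contiguity_class_comp_left
          [OF same_contiguity_class_comp_right[OF proj'[rule_format, OF i] \<phi>\<phi>] \<psi>]
      by (simp add: fst_comp_map_prod snd_comp_map_prod comp_assoc)
    moreover have "same_contiguity_class (\<Omega> i) K (\<psi> \<circ> \<phi> \<circ> snd) snd"
      using same_contiguity_class_sym[OF same_contiguity_class_comp_right[OF dom p2]] by simp
    ultimately show ?thesis
      by (blast intro: same_contiguity_class_trans)
  qed
  show "\<exists>m. enat n = enat m \<and> (\<exists>\<Omega> :: nat \<Rightarrow> ('a \<times> 'a) set set.
       (\<forall>i\<le>m. subcomplex (\<Omega> i) (cat_product K L)) \<and>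
       cat_product K L = (\<Union>i\<le>m. \<Omega> i) \<and>
       (\<forall>i\<le>m. same_contiguity_class (\<Omega> i) K fst snd))"
    using sub cover proj by blast
qed

theorem theorem4p2:
  fixes K L :: "'a set set" and K' L' :: "'b set set"
  assumes "simplicial_complex K" and "finite K"
    and "simplicial_complex K'" and "finite K'"
    and "subcomplex L K" and "subcomplex L' K'"
    and "same_strong_homotopy_type K L K' L'"
  shows "TC K L = TC K' L'"
proof -
  from assms(7) obtain \<phi> \<psi> F H where
    maps: "simplicial_map K K' \<phi>" "simplicial_map K' K \<psi>"
      "simplicial_map L L' \<phi>" "simplicial_map L' L \<psi>"
    and "p_homotopy K K id (\<psi> \<circ> \<phi>) F" "p_homotopy K' K' id (\<phi> \<circ> \<psi>) H"
    unfolding same_strong_homotopy_type_def simplicial_map_def by blast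
  then have "same_contiguity_class K K id (\<psi> \<circ> \<phi>)" "same_contiguity_class K' K' id (\<phi> \<circ> \<psi>)"
    using assms(1-4) by (blast intro: same_contiguity_class_if_p_homotopy)+
  then show ?thesis
    using assms(1,3,5,6) maps by (intro antisym) (blast intro: TC_le_if_dominated)+
qed

end
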